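(* Let $A=(a_{ij})_{1\le i,j\le 3}$ be a $3\times 3$ matrix with positive real entries, and let $x$ be the $(1,1)$ entry of the Sinkhorn limit $\mathrm{Sink}(A)$. Then $x$ satisfies \[ b_6x^6+b_5x^5+b_4x^4+b_3x^3+b_2x^2+b_1x+b_0=0, \] where \begin{align*} b_6={}&(a_{11}a_{22}-a_{12}a_{21})(a_{11}a_{23}-a_{13}a_{21})(a_{11}a_{32}-a_{12}a_{31})(a_{11}a_{33}-a_{13}a_{31})\\ &\cdot(a_{11}a_{22}a_{33}-a_{11}a_{23}a_{32}-a_{12}a_{21}a_{33}+a_{12}a_{23}a_{31}+a_{13}a_{21}a_{32}-a_{13}a_{22}a_{31}),\\[4pt] b_5={}&-6a_{11}^5a_{22}^2a_{23}a_{32}a_{33}^2+6a_{11}^5a_{22}a_{23}^2a_{32}^2a_{33}+8a_{11}^4a_{12}a_{21}a_{22}a_{23}a_{32}a_{33}^2\\ &-5a_{11}^4a_{12}a_{21}a_{23}^2a_{32}^2a_{33}+5a_{11}^4a_{12}a_{22}^2a_{23}a_{31}a_{33}^2-8a_{11}^4a_{12}a_{22}a_{23}^2a_{31}a_{32}a_{33}\\ &+5a_{11}^4a_{13}a_{21}a_{22}^2a_{32}a_{33}^2-8a_{11}^4a_{13}a_{21}a_{22}a_{23}a_{32}^2a_{33}+8a_{11}^4a_{13}a_{22}^2a_{23}a_{31}a_{32}a_{33}\\ &-5a_{11}^4a_{13}a_{22}a_{23}^2a_{31}a_{32}^2-2a_{11}^3a_{12}^2a_{21}^2a_{23}a_{32}a_{33}^2-6a_{11}^3a_{12}^2a_{21}a_{22}a_{23}a_{31}a_{33}^2\\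 &+6a_{11}^3a_{12}^2a_{21}a_{23}^2a_{31}a_{32}a_{33}+2a_{11}^3a_{12}^2a_{22}a_{23}^2a_{31}^2a_{33}-6a_{11}^3a_{12}a_{13}a_{21}^2a_{22}a_{32}a_{33}^2\\ &+6a_{11}^3a_{12}a_{13}a_{21}^2a_{23}a_{32}^2a_{33}-4a_{11}^3a_{12}a_{13}a_{21}a_{22}^2a_{31}a_{33}^2+4a_{11}^3a_{12}a_{13}a_{21}a_{23}^2a_{31}a_{32}^2\\ &-6a_{11}^3a_{12}a_{13}a_{22}^2a_{23}a_{31}^2a_{33}+6a_{11}^3a_{12}a_{13}a_{22}a_{23}^2a_{31}^2a_{32}+2a_{11}^3a_{13}^2a_{21}^2a_{22}a_{32}^2a_{33}\\ &-6a_{11}^3a_{13}^2a_{21}a_{22}^2a_{31}a_{32}a_{33}+6a_{11}^3a_{13}^2a_{21}a_{22}a_{23}a_{31}a_{32}^2-2a_{11}^3a_{13}^2a_{22}^2a_{23}a_{31}^2a_{32}\\ &+a_{11}^2a_{12}^3a_{21}^2a_{23}a_{31}a_{33}^2-a_{11}^2a_{12}^3a_{21}a_{23}^2a_{31}^2a_{33}+a_{11}^2a_{12}^2a_{13}a_{21}^3a_{32}a_{33}^2\\ &+4a_{11}^2a_{12}^2a_{13}a_{21}^2a_{22}a_{31}a_{33}^2-4a_{11}^2a_{12}^2a_{13}a_{21}^2a_{23}a_{31}a_{32}a_{33}\\ &+4a_{11}^2a_{12}^2a_{13}a_{21}a_{22}a_{23}a_{31}^2a_{33}-4a_{11}^2a_{12}^2a_{13}a_{21}a_{23}^2a_{31}^2a_{32}-a_{11}^2a_{12}^2a_{13}a_{22}a_{23}^2a_{31}^3\\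 &-a_{11}^2a_{12}a_{13}^2a_{21}^3a_{32}^2a_{33}+4a_{11}^2a_{12}a_{13}^2a_{21}^2a_{22}a_{31}a_{32}a_{33}-4a_{11}^2a_{12}a_{13}^2a_{21}^2a_{23}a_{31}a_{32}^2\\ &+4a_{11}^2a_{12}a_{13}^2a_{21}a_{22}^2a_{31}^2a_{33}-4a_{11}^2a_{12}a_{13}^2a_{21}a_{22}a_{23}a_{31}^2a_{32}+a_{11}^2a_{12}a_{13}^2a_{22}^2a_{23}a_{31}^3\\ &-a_{11}^2a_{13}^3a_{21}^2a_{22}a_{31}a_{32}^2+a_{11}^2a_{13}^3a_{21}a_{22}^2a_{31}^2a_{32}-2a_{11}a_{12}^2a_{13}^2a_{21}^2a_{22}a_{31}^2a_{33}\\ &+2a_{11}a_{12}^2a_{13}^2a_{21}^2a_{23}a_{31}^2a_{32}-a_{12}^3a_{13}^2a_{21}^3a_{31}^2a_{33}+a_{12}^3a_{13}^2a_{21}^2a_{23}a_{31}^3\\ &+a_{12}^2a_{13}^3a_{21}^3a_{31}^2a_{32}-a_{12}^2a_{13}^3a_{21}^2a_{22}a_{31}^3,\\[4pt] b_4={}&a_{11}\big(15a_{11}^4a_{22}^2a_{23}a_{32}a_{33}^2-15a_{11}^4a_{22}a_{23}^2a_{32}^2a_{33}-12a_{11}^3a_{12}a_{21}a_{22}a_{23}a_{32}a_{33}^2\\ &+10a_{11}^3a_{12}a_{21}a_{23}^2a_{32}^2a_{33}-10a_{11}^3a_{12}a_{22}^2a_{23}a_{31}a_{33}^2+12a_{11}^3a_{12}a_{22}a_{23}^2a_{31}a_{32}a_{33}\\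 &-10a_{11}^3a_{13}a_{21}a_{22}^2a_{32}a_{33}^2+12a_{11}^3a_{13}a_{21}a_{22}a_{23}a_{32}^2a_{33}-12a_{11}^3a_{13}a_{22}^2a_{23}a_{31}a_{32}a_{33}\\ &+10a_{11}^3a_{13}a_{22}a_{23}^2a_{31}a_{32}^2+a_{11}^2a_{12}^2a_{21}^2a_{23}a_{32}a_{33}^2+6a_{11}^2a_{12}^2a_{21}a_{22}a_{23}a_{31}a_{33}^2\\ &-6a_{11}^2a_{12}^2a_{21}a_{23}^2a_{31}a_{32}a_{33}-a_{11}^2a_{12}^2a_{22}a_{23}^2a_{31}^2a_{33}+6a_{11}^2a_{12}a_{13}a_{21}^2a_{22}a_{32}a_{33}^2\\ &-6a_{11}^2a_{12}a_{13}a_{21}^2a_{23}a_{32}^2a_{33}+6a_{11}^2a_{12}a_{13}a_{21}a_{22}^2a_{31}a_{33}^2-6a_{11}^2a_{12}a_{13}a_{21}a_{23}^2a_{31}a_{32}^2\\ &+6a_{11}^2a_{12}a_{13}a_{22}^2a_{23}a_{31}^2a_{33}-6a_{11}^2a_{12}a_{13}a_{22}a_{23}^2a_{31}^2a_{32}-a_{11}^2a_{13}^2a_{21}^2a_{22}a_{32}^2a_{33}\\ &+6a_{11}^2a_{13}^2a_{21}a_{22}^2a_{31}a_{32}a_{33}-6a_{11}^2a_{13}^2a_{21}a_{22}a_{23}a_{31}a_{32}^2+a_{11}^2a_{13}^2a_{22}^2a_{23}a_{31}^2a_{32}\\ &-2a_{11}a_{12}^2a_{13}a_{21}^2a_{22}a_{31}a_{33}^2+2a_{11}a_{12}^2a_{13}a_{21}a_{23}^2a_{31}^2a_{32}+2a_{11}a_{12}a_{13}^2a_{21}^2a_{23}a_{31}a_{32}^2\\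 &-2a_{11}a_{12}a_{13}^2a_{21}a_{22}^2a_{31}^2a_{33}-3a_{12}^2a_{13}^2a_{21}^2a_{22}a_{31}^2a_{33}+3a_{12}^2a_{13}^2a_{21}^2a_{23}a_{31}^2a_{32}\big),\\[4pt] b_3={}&2a_{11}^2\big(-10a_{11}^3a_{22}^2a_{23}a_{32}a_{33}^2+10a_{11}^3a_{22}a_{23}^2a_{32}^2a_{33}+4a_{11}^2a_{12}a_{21}a_{22}a_{23}a_{32}a_{33}^2\\ &-5a_{11}^2a_{12}a_{21}a_{23}^2a_{32}^2a_{33}+5a_{11}^2a_{12}a_{22}^2a_{23}a_{31}a_{33}^2-4a_{11}^2a_{12}a_{22}a_{23}^2a_{31}a_{32}a_{33}\\ &+5a_{11}^2a_{13}a_{21}a_{22}^2a_{32}a_{33}^2-4a_{11}^2a_{13}a_{21}a_{22}a_{23}a_{32}^2a_{33}+4a_{11}^2a_{13}a_{22}^2a_{23}a_{31}a_{32}a_{33}\\ &-5a_{11}^2a_{13}a_{22}a_{23}^2a_{31}a_{32}^2-a_{11}a_{12}^2a_{21}a_{22}a_{23}a_{31}a_{33}^2+a_{11}a_{12}^2a_{21}a_{23}^2a_{31}a_{32}a_{33}\\ &-a_{11}a_{12}a_{13}a_{21}^2a_{22}a_{32}a_{33}^2+a_{11}a_{12}a_{13}a_{21}^2a_{23}a_{32}^2a_{33}-2a_{11}a_{12}a_{13}a_{21}a_{22}^2a_{31}a_{33}^2\\ &+2a_{11}a_{12}a_{13}a_{21}a_{23}^2a_{31}a_{32}^2-a_{11}a_{12}a_{13}a_{22}^2a_{23}a_{31}^2a_{33}+a_{11}a_{12}a_{13}a_{22}a_{23}^2a_{31}^2a_{32}\\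 &-a_{11}a_{13}^2a_{21}a_{22}^2a_{31}a_{32}a_{33}+a_{11}a_{13}^2a_{21}a_{22}a_{23}a_{31}a_{32}^2+a_{12}^2a_{13}a_{21}^2a_{23}a_{31}a_{32}a_{33}\\ &-a_{12}^2a_{13}a_{21}a_{22}a_{23}a_{31}^2a_{33}-a_{12}a_{13}^2a_{21}^2a_{22}a_{31}a_{32}a_{33}+a_{12}a_{13}^2a_{21}a_{22}a_{23}a_{31}^2a_{32}\big),\\[4pt] b_2={}&a_{11}^3\big(15a_{11}^2a_{22}^2a_{23}a_{32}a_{33}^2-15a_{11}^2a_{22}a_{23}^2a_{32}^2a_{33}-2a_{11}a_{12}a_{21}a_{22}a_{23}a_{32}a_{33}^2\\ &+5a_{11}a_{12}a_{21}a_{23}^2a_{32}^2a_{33}-5a_{11}a_{12}a_{22}^2a_{23}a_{31}a_{33}^2+2a_{11}a_{12}a_{22}a_{23}^2a_{31}a_{32}a_{33}\\ &-5a_{11}a_{13}a_{21}a_{22}^2a_{32}a_{33}^2+2a_{11}a_{13}a_{21}a_{22}a_{23}a_{32}^2a_{33}-2a_{11}a_{13}a_{22}^2a_{23}a_{31}a_{32}a_{33}\\ &+5a_{11}a_{13}a_{22}a_{23}^2a_{31}a_{32}^2+a_{12}a_{13}a_{21}a_{22}^2a_{31}a_{33}^2-a_{12}a_{13}a_{21}a_{23}^2a_{31}a_{32}^2\big),\\[4pt] b_1={}&a_{11}^4\big(-6a_{11}a_{22}^2a_{23}a_{32}a_{33}^2+6a_{11}a_{22}a_{23}^2a_{32}^2a_{33}-a_{12}a_{21}a_{23}^2a_{32}^2a_{33}\\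 &+a_{12}a_{22}^2a_{23}a_{31}a_{33}^2+a_{13}a_{21}a_{22}^2a_{32}a_{33}^2-a_{13}a_{22}a_{23}^2a_{31}a_{32}^2\big),\\[4pt] b_0={}&a_{11}^5a_{22}a_{23}a_{32}a_{33}(a_{22}a_{33}-a_{23}a_{32}). \end{align*}
   Context: For a square matrix $A$ with positive real entries, the Sinkhorn limit $\mathrm{Sink}(A)$ is the limit of the sequence of matrices obtained from $A$ by alternately scaling all rows so that each row sum is $1$ and then scaling all columns so that each column sum is $1$. Equivalently, it is the unique doubly stochastic matrix $S$ (nonnegative entries, all row and column sums equal to $1$) of the same size as $A$ such that $S=RAC$ for some diagonal matrices $R,C$ with positive diagonal entries. *)

theory Defs
  imports "HOL-Analysis.Analysis"
begin

definition scale_rows :: "real^'n^'n \<Rightarrow> real^'n^'n" where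
  "scale_rows A = (\<chi> i j. A$i$j / (\<Sum>k\<in>UNIV. A$i$k))"

definition scale_cols :: "real^'n^'n \<Rightarrow> real^'n^'n" where
  "scale_cols A = (\<chi> i j. A$i$j / (\<Sum>k\<in>UNIV. A$k$j))"

text \<open>Every half-step is a term of the sequence, so a limit of it has unit row sums
  and unit column sums.\<close>

primrec sinkhorn_seq :: "real^'n^'n \<Rightarrow> nat \<Rightarrow> real^'n^'n" where
  "sinkhorn_seq A 0 = A"
| "sinkhorn_seq A (Suc k) =
     (if even k then scale_rows (sinkhorn_seq A k) else scale_cols (sinkhorn_seq A k))"

text \<open>The value is meaningful only if the sequence converges, as it does for
  matrices with positive entries; this is not built into the definition.\<close>

definition sinkhorn_limit :: "real^'n^'n \<Rightarrow> real^'n^'n" where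
  "sinkhorn_limit A = lim (sinkhorn_seq A)"

text \<open>Coefficients of the sextic satisfied by the (1,1) entry of the Sinkhorn limit
  of a 3-by-3 matrix.  In the index type \<^typ>\<open>3\<close> the numeral 3 equals 0, so the
  indices 1, 2, 3 are its three distinct elements.\<close>

definition sinkhorn_b6 :: "real^3^3 \<Rightarrow> real" where
  "sinkhorn_b6 A =
     (A$1$1 * A$2$2 - A$1$2 * A$2$1) * (A$1$1 * A$2$3 - A$1$3 * A$2$1)
     * (A$1$1 * A$3$2 - A$1$2 * A$3$1) * (A$1$1 * A$3$3 - A$1$3 * A$3$1)
     * (A$1$1 * A$2$2 * A$3$3 - A$1$1 * A$2$3 * A$3$2 - A$1$2 * A$2$1 * A$3$3
        + A$1$2 * A$2$3 * A$3$1 + A$1$3 * A$2$1 * A$3$2 - A$1$3 * A$2$2 * A$3$1)"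

definition sinkhorn_b5 :: "real^3^3 \<Rightarrow> real" where
  "sinkhorn_b5 A =
     - 6 * A$1$1^5 * A$2$2^2 * A$2$3 * A$3$2 * A$3$3^2
     + 6 * A$1$1^5 * A$2$2 * A$2$3^2 * A$3$2^2 * A$3$3
     + 8 * A$1$1^4 * A$1$2 * A$2$1 * A$2$2 * A$2$3 * A$3$2 * A$3$3^2
     - 5 * A$1$1^4 * A$1$2 * A$2$1 * A$2$3^2 * A$3$2^2 * A$3$3
     + 5 * A$1$1^4 * A$1$2 * A$2$2^2 * A$2$3 * A$3$1 * A$3$3^2
     - 8 * A$1$1^4 * A$1$2 * A$2$2 * A$2$3^2 * A$3$1 * A$3$2 * A$3$3
     + 5 * A$1$1^4 * A$1$3 * A$2$1 * A$2$2^2 * A$3$2 * A$3$3^2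
     - 8 * A$1$1^4 * A$1$3 * A$2$1 * A$2$2 * A$2$3 * A$3$2^2 * A$3$3
     + 8 * A$1$1^4 * A$1$3 * A$2$2^2 * A$2$3 * A$3$1 * A$3$2 * A$3$3
     - 5 * A$1$1^4 * A$1$3 * A$2$2 * A$2$3^2 * A$3$1 * A$3$2^2
     - 2 * A$1$1^3 * A$1$2^2 * A$2$1^2 * A$2$3 * A$3$2 * A$3$3^2
     - 6 * A$1$1^3 * A$1$2^2 * A$2$1 * A$2$2 * A$2$3 * A$3$1 * A$3$3^2
     + 6 * A$1$1^3 * A$1$2^2 * A$2$1 * A$2$3^2 * A$3$1 * A$3$2 * A$3$3
     + 2 * A$1$1^3 * A$1$2^2 * A$2$2 * A$2$3^2 * A$3$1^2 * A$3$3
     - 6 * A$1$1^3 * A$1$2 * A$1$3 * A$2$1^2 * A$2$2 * A$3$2 * A$3$3^2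
     + 6 * A$1$1^3 * A$1$2 * A$1$3 * A$2$1^2 * A$2$3 * A$3$2^2 * A$3$3
     - 4 * A$1$1^3 * A$1$2 * A$1$3 * A$2$1 * A$2$2^2 * A$3$1 * A$3$3^2
     + 4 * A$1$1^3 * A$1$2 * A$1$3 * A$2$1 * A$2$3^2 * A$3$1 * A$3$2^2
     - 6 * A$1$1^3 * A$1$2 * A$1$3 * A$2$2^2 * A$2$3 * A$3$1^2 * A$3$3
     + 6 * A$1$1^3 * A$1$2 * A$1$3 * A$2$2 * A$2$3^2 * A$3$1^2 * A$3$2
     + 2 * A$1$1^3 * A$1$3^2 * A$2$1^2 * A$2$2 * A$3$2^2 * A$3$3
     - 6 * A$1$1^3 * A$1$3^2 * A$2$1 * A$2$2^2 * A$3$1 * A$3$2 * A$3$3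
     + 6 * A$1$1^3 * A$1$3^2 * A$2$1 * A$2$2 * A$2$3 * A$3$1 * A$3$2^2
     - 2 * A$1$1^3 * A$1$3^2 * A$2$2^2 * A$2$3 * A$3$1^2 * A$3$2
     + A$1$1^2 * A$1$2^3 * A$2$1^2 * A$2$3 * A$3$1 * A$3$3^2
     - A$1$1^2 * A$1$2^3 * A$2$1 * A$2$3^2 * A$3$1^2 * A$3$3
     + A$1$1^2 * A$1$2^2 * A$1$3 * A$2$1^3 * A$3$2 * A$3$3^2
     + 4 * A$1$1^2 * A$1$2^2 * A$1$3 * A$2$1^2 * A$2$2 * A$3$1 * A$3$3^2
     - 4 * A$1$1^2 * A$1$2^2 * A$1$3 * A$2$1^2 * A$2$3 * A$3$1 * A$3$2 * A$3$3
     + 4 * A$1$1^2 * A$1$2^2 * A$1$3 * A$2$1 * A$2$2 * A$2$3 * A$3$1^2 * A$3$3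
     - 4 * A$1$1^2 * A$1$2^2 * A$1$3 * A$2$1 * A$2$3^2 * A$3$1^2 * A$3$2
     - A$1$1^2 * A$1$2^2 * A$1$3 * A$2$2 * A$2$3^2 * A$3$1^3
     - A$1$1^2 * A$1$2 * A$1$3^2 * A$2$1^3 * A$3$2^2 * A$3$3
     + 4 * A$1$1^2 * A$1$2 * A$1$3^2 * A$2$1^2 * A$2$2 * A$3$1 * A$3$2 * A$3$3
     - 4 * A$1$1^2 * A$1$2 * A$1$3^2 * A$2$1^2 * A$2$3 * A$3$1 * A$3$2^2
     + 4 * A$1$1^2 * A$1$2 * A$1$3^2 * A$2$1 * A$2$2^2 * A$3$1^2 * A$3$3
     - 4 * A$1$1^2 * A$1$2 * A$1$3^2 * A$2$1 * A$2$2 * A$2$3 * A$3$1^2 * A$3$2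
     + A$1$1^2 * A$1$2 * A$1$3^2 * A$2$2^2 * A$2$3 * A$3$1^3
     - A$1$1^2 * A$1$3^3 * A$2$1^2 * A$2$2 * A$3$1 * A$3$2^2
     + A$1$1^2 * A$1$3^3 * A$2$1 * A$2$2^2 * A$3$1^2 * A$3$2
     - 2 * A$1$1 * A$1$2^2 * A$1$3^2 * A$2$1^2 * A$2$2 * A$3$1^2 * A$3$3
     + 2 * A$1$1 * A$1$2^2 * A$1$3^2 * A$2$1^2 * A$2$3 * A$3$1^2 * A$3$2
     - A$1$2^3 * A$1$3^2 * A$2$1^3 * A$3$1^2 * A$3$3 + A$1$2^3 * A$1$3^2 * A$2$1^2 * A$2$3 * A$3$1^3
     + A$1$2^2 * A$1$3^3 * A$2$1^3 * A$3$1^2 * A$3$2 - A$1$2^2 * A$1$3^3 * A$2$1^2 * A$2$2 * A$3$1^3"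

definition sinkhorn_b4 :: "real^3^3 \<Rightarrow> real" where
  "sinkhorn_b4 A =
     A$1$1 * (15 * A$1$1^4 * A$2$2^2 * A$2$3 * A$3$2 * A$3$3^2
     - 15 * A$1$1^4 * A$2$2 * A$2$3^2 * A$3$2^2 * A$3$3
     - 12 * A$1$1^3 * A$1$2 * A$2$1 * A$2$2 * A$2$3 * A$3$2 * A$3$3^2
     + 10 * A$1$1^3 * A$1$2 * A$2$1 * A$2$3^2 * A$3$2^2 * A$3$3
     - 10 * A$1$1^3 * A$1$2 * A$2$2^2 * A$2$3 * A$3$1 * A$3$3^2
     + 12 * A$1$1^3 * A$1$2 * A$2$2 * A$2$3^2 * A$3$1 * A$3$2 * A$3$3
     - 10 * A$1$1^3 * A$1$3 * A$2$1 * A$2$2^2 * A$3$2 * A$3$3^2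
     + 12 * A$1$1^3 * A$1$3 * A$2$1 * A$2$2 * A$2$3 * A$3$2^2 * A$3$3
     - 12 * A$1$1^3 * A$1$3 * A$2$2^2 * A$2$3 * A$3$1 * A$3$2 * A$3$3
     + 10 * A$1$1^3 * A$1$3 * A$2$2 * A$2$3^2 * A$3$1 * A$3$2^2
     + A$1$1^2 * A$1$2^2 * A$2$1^2 * A$2$3 * A$3$2 * A$3$3^2
     + 6 * A$1$1^2 * A$1$2^2 * A$2$1 * A$2$2 * A$2$3 * A$3$1 * A$3$3^2
     - 6 * A$1$1^2 * A$1$2^2 * A$2$1 * A$2$3^2 * A$3$1 * A$3$2 * A$3$3
     - A$1$1^2 * A$1$2^2 * A$2$2 * A$2$3^2 * A$3$1^2 * A$3$3
     + 6 * A$1$1^2 * A$1$2 * A$1$3 * A$2$1^2 * A$2$2 * A$3$2 * A$3$3^2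
     - 6 * A$1$1^2 * A$1$2 * A$1$3 * A$2$1^2 * A$2$3 * A$3$2^2 * A$3$3
     + 6 * A$1$1^2 * A$1$2 * A$1$3 * A$2$1 * A$2$2^2 * A$3$1 * A$3$3^2
     - 6 * A$1$1^2 * A$1$2 * A$1$3 * A$2$1 * A$2$3^2 * A$3$1 * A$3$2^2
     + 6 * A$1$1^2 * A$1$2 * A$1$3 * A$2$2^2 * A$2$3 * A$3$1^2 * A$3$3
     - 6 * A$1$1^2 * A$1$2 * A$1$3 * A$2$2 * A$2$3^2 * A$3$1^2 * A$3$2
     - A$1$1^2 * A$1$3^2 * A$2$1^2 * A$2$2 * A$3$2^2 * A$3$3
     + 6 * A$1$1^2 * A$1$3^2 * A$2$1 * A$2$2^2 * A$3$1 * A$3$2 * A$3$3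
     - 6 * A$1$1^2 * A$1$3^2 * A$2$1 * A$2$2 * A$2$3 * A$3$1 * A$3$2^2
     + A$1$1^2 * A$1$3^2 * A$2$2^2 * A$2$3 * A$3$1^2 * A$3$2
     - 2 * A$1$1 * A$1$2^2 * A$1$3 * A$2$1^2 * A$2$2 * A$3$1 * A$3$3^2
     + 2 * A$1$1 * A$1$2^2 * A$1$3 * A$2$1 * A$2$3^2 * A$3$1^2 * A$3$2
     + 2 * A$1$1 * A$1$2 * A$1$3^2 * A$2$1^2 * A$2$3 * A$3$1 * A$3$2^2
     - 2 * A$1$1 * A$1$2 * A$1$3^2 * A$2$1 * A$2$2^2 * A$3$1^2 * A$3$3
     - 3 * A$1$2^2 * A$1$3^2 * A$2$1^2 * A$2$2 * A$3$1^2 * A$3$3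
     + 3 * A$1$2^2 * A$1$3^2 * A$2$1^2 * A$2$3 * A$3$1^2 * A$3$2)"

definition sinkhorn_b3 :: "real^3^3 \<Rightarrow> real" where
  "sinkhorn_b3 A =
     2 * A$1$1^2 * (- 10 * A$1$1^3 * A$2$2^2 * A$2$3 * A$3$2 * A$3$3^2
     + 10 * A$1$1^3 * A$2$2 * A$2$3^2 * A$3$2^2 * A$3$3
     + 4 * A$1$1^2 * A$1$2 * A$2$1 * A$2$2 * A$2$3 * A$3$2 * A$3$3^2
     - 5 * A$1$1^2 * A$1$2 * A$2$1 * A$2$3^2 * A$3$2^2 * A$3$3
     + 5 * A$1$1^2 * A$1$2 * A$2$2^2 * A$2$3 * A$3$1 * A$3$3^2
     - 4 * A$1$1^2 * A$1$2 * A$2$2 * A$2$3^2 * A$3$1 * A$3$2 * A$3$3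
     + 5 * A$1$1^2 * A$1$3 * A$2$1 * A$2$2^2 * A$3$2 * A$3$3^2
     - 4 * A$1$1^2 * A$1$3 * A$2$1 * A$2$2 * A$2$3 * A$3$2^2 * A$3$3
     + 4 * A$1$1^2 * A$1$3 * A$2$2^2 * A$2$3 * A$3$1 * A$3$2 * A$3$3
     - 5 * A$1$1^2 * A$1$3 * A$2$2 * A$2$3^2 * A$3$1 * A$3$2^2
     - A$1$1 * A$1$2^2 * A$2$1 * A$2$2 * A$2$3 * A$3$1 * A$3$3^2
     + A$1$1 * A$1$2^2 * A$2$1 * A$2$3^2 * A$3$1 * A$3$2 * A$3$3
     - A$1$1 * A$1$2 * A$1$3 * A$2$1^2 * A$2$2 * A$3$2 * A$3$3^2
     + A$1$1 * A$1$2 * A$1$3 * A$2$1^2 * A$2$3 * A$3$2^2 * A$3$3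
     - 2 * A$1$1 * A$1$2 * A$1$3 * A$2$1 * A$2$2^2 * A$3$1 * A$3$3^2
     + 2 * A$1$1 * A$1$2 * A$1$3 * A$2$1 * A$2$3^2 * A$3$1 * A$3$2^2
     - A$1$1 * A$1$2 * A$1$3 * A$2$2^2 * A$2$3 * A$3$1^2 * A$3$3
     + A$1$1 * A$1$2 * A$1$3 * A$2$2 * A$2$3^2 * A$3$1^2 * A$3$2
     - A$1$1 * A$1$3^2 * A$2$1 * A$2$2^2 * A$3$1 * A$3$2 * A$3$3
     + A$1$1 * A$1$3^2 * A$2$1 * A$2$2 * A$2$3 * A$3$1 * A$3$2^2
     + A$1$2^2 * A$1$3 * A$2$1^2 * A$2$3 * A$3$1 * A$3$2 * A$3$3
     - A$1$2^2 * A$1$3 * A$2$1 * A$2$2 * A$2$3 * A$3$1^2 * A$3$3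
     - A$1$2 * A$1$3^2 * A$2$1^2 * A$2$2 * A$3$1 * A$3$2 * A$3$3
     + A$1$2 * A$1$3^2 * A$2$1 * A$2$2 * A$2$3 * A$3$1^2 * A$3$2)"

definition sinkhorn_b2 :: "real^3^3 \<Rightarrow> real" where
  "sinkhorn_b2 A =
     A$1$1^3 * (15 * A$1$1^2 * A$2$2^2 * A$2$3 * A$3$2 * A$3$3^2
     - 15 * A$1$1^2 * A$2$2 * A$2$3^2 * A$3$2^2 * A$3$3
     - 2 * A$1$1 * A$1$2 * A$2$1 * A$2$2 * A$2$3 * A$3$2 * A$3$3^2
     + 5 * A$1$1 * A$1$2 * A$2$1 * A$2$3^2 * A$3$2^2 * A$3$3
     - 5 * A$1$1 * A$1$2 * A$2$2^2 * A$2$3 * A$3$1 * A$3$3^2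
     + 2 * A$1$1 * A$1$2 * A$2$2 * A$2$3^2 * A$3$1 * A$3$2 * A$3$3
     - 5 * A$1$1 * A$1$3 * A$2$1 * A$2$2^2 * A$3$2 * A$3$3^2
     + 2 * A$1$1 * A$1$3 * A$2$1 * A$2$2 * A$2$3 * A$3$2^2 * A$3$3
     - 2 * A$1$1 * A$1$3 * A$2$2^2 * A$2$3 * A$3$1 * A$3$2 * A$3$3
     + 5 * A$1$1 * A$1$3 * A$2$2 * A$2$3^2 * A$3$1 * A$3$2^2
     + A$1$2 * A$1$3 * A$2$1 * A$2$2^2 * A$3$1 * A$3$3^2
     - A$1$2 * A$1$3 * A$2$1 * A$2$3^2 * A$3$1 * A$3$2^2)"

definition sinkhorn_b1 :: "real^3^3 \<Rightarrow> real" where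
  "sinkhorn_b1 A =
     A$1$1^4 * (- 6 * A$1$1 * A$2$2^2 * A$2$3 * A$3$2 * A$3$3^2
     + 6 * A$1$1 * A$2$2 * A$2$3^2 * A$3$2^2 * A$3$3 - A$1$2 * A$2$1 * A$2$3^2 * A$3$2^2 * A$3$3
     + A$1$2 * A$2$2^2 * A$2$3 * A$3$1 * A$3$3^2 + A$1$3 * A$2$1 * A$2$2^2 * A$3$2 * A$3$3^2
     - A$1$3 * A$2$2 * A$2$3^2 * A$3$1 * A$3$2^2)"

definition sinkhorn_b0 :: "real^3^3 \<Rightarrow> real" where
  "sinkhorn_b0 A =
     A$1$1^5 * A$2$2 * A$2$3 * A$3$2 * A$3$3 * (A$2$2 * A$3$3 - A$2$3 * A$3$2)"

end

theory Submission
  imports Defs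
begin

text \<open>Measure the defect of a matrix by the largest ratio of two of its line sums. A half-step of
  the iteration replaces these line sums by weighted means of their reciprocals, with weights
  bounded below since scaling preserves all cross ratios; so the defect decays geometrically and
  the iteration converges to a positive doubly stochastic matrix \<open>S\<close> with the cross
  ratios of \<open>A\<close>, that is, \<open>A\<^sub>i\<^sub>j = r\<^sub>i S\<^sub>i\<^sub>j c\<^sub>j\<close>. Each \<open>b\<^sub>k\<close> has degree 5 in the first row and in the
  first column and degree 3 in the other rows and columns, so passing from \<open>A\<close> to \<open>S\<close> multiplies
  all \<open>b\<^sub>k\<close> by one common factor. For doubly stochastic \<open>S\<close> the sextic becomes a polynomial
  identity in the four entries of the upper left block.\<close>


section \<open>Scalings and the aligned iteration\<close>

lemma transpose_nth: "transpose M $ i $ j = M $ j $ i"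
  by (simp add: transpose_def)

lemma scale_rows_nth: "scale_rows M $ i $ j = M$i$j / (\<Sum>k\<in>UNIV. M$i$k)"
  by (simp add: scale_rows_def)

lemma scale_cols_conv_scale_rows: "scale_cols M = transpose (scale_rows (transpose M))"
  by (simp add: scale_cols_def scale_rows_def transpose_def vec_eq_iff)

definition half_step :: "real^'n^'n \<Rightarrow> real^'n^'n" where
  "half_step M = transpose (scale_rows M)"

text \<open>Transposing the terms of odd index turns both kinds of scaling into the same map
  \<^const>\<open>half_step\<close>; from index 1 on, every term has unit column sums.\<close>

definition aligned_seq :: "real^'n^'n \<Rightarrow> nat \<Rightarrow> real^'n^'n" where
  "aligned_seq A k = (if even k then sinkhorn_seq A k else transpose (sinkhorn_seq A k))"

lemma aligned_seq_Suc: "aligned_seq A (Suc k) = half_step (aligned_seq A k)"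
  by (simp add: aligned_seq_def half_step_def scale_cols_conv_scale_rows)

lemma sinkhorn_seq_conv_aligned_seq:
  "sinkhorn_seq A k = (if even k then aligned_seq A k else transpose (aligned_seq A k))"
  by (simp add: aligned_seq_def)

lemma sinkhorn_step_conv_aligned_seq:
  "sinkhorn_seq A (Suc k) $ i $ j - sinkhorn_seq A k $ i $ j =
    (if even k then scale_rows (aligned_seq A k) $ i $ j - aligned_seq A k $ i $ j
     else scale_rows (aligned_seq A k) $ j $ i - aligned_seq A k $ j $ i)"
  by (simp add: aligned_seq_def scale_cols_conv_scale_rows transpose_nth)

section \<open>Estimates for a single half-step\<close>

lemma row_sum_pos:
  fixes M :: "real^'n^'n"
  assumes "\<And>i j. M$i$j > 0"
  shows "(\<Sum>k\<in>UNIV. M$i$k) > 0"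
  using assms by (intro sum_pos) auto

lemma half_step_pos:
  fixes M :: "real^'n^'n"
  assumes "\<And>i j. M$i$j > 0"
  shows "half_step M $ i $ j > 0"
  using assms row_sum_pos[of M] by (simp add: half_step_def transpose_nth scale_rows_nth)

lemma half_step_col_sum:
  fixes M :: "real^'n^'n"
  assumes "\<And>i j. M$i$j > 0"
  shows "(\<Sum>i\<in>UNIV. half_step M $ i $ j) = 1"
  using row_sum_pos[of M j] assms
  by (simp add: half_step_def transpose_nth scale_rows_nth sum_divide_distrib[symmetric])

text \<open>A lower bound on all cross ratios is invariant under row scaling and transposition.
  By \<open>entry_lower_bound\<close> it keeps the entries away from zero.\<close>

lemma half_step_minor_bound:
  fixes M :: "real^'n^'n"
  assumes pos: "\<And>i j. M$i$j > 0"
    and bound: "\<And>i j k l. \<kappa> * (M$i$l * M$k$j) \<le> M$i$j * M$k$l"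
  shows "\<kappa> * (half_step M $ i $ l * half_step M $ k $ j)
    \<le> half_step M $ i $ j * half_step M $ k $ l"
proof -
  let ?s = "\<lambda>i. \<Sum>k\<in>UNIV. M$i$k"
  have "\<kappa> * (M$j$k * M$l$i) / (?s l * ?s j) \<le> M$j$i * M$l$k / (?s l * ?s j)"
    using bound row_sum_pos[of M] pos by (intro divide_right_mono) (auto intro!: less_imp_le)
  then show ?thesis
    by (simp add: half_step_def transpose_nth scale_rows_nth mult_ac)
qed

text \<open>Unit column sums make the mean of the row sums 1. Averaging \<open>ratio\<close> over
  \<open>i'\<close> bounds each row sum from above; averaging it with the two rows exchanged bounds
  it from below.\<close>

lemma line_sum_bounds:
  fixes M :: "real^'n^'n"
  assumes pos: "\<And>i j. M$i$j > 0"
    and col: "\<And>j. (\<Sum>i\<in>UNIV. M$i$j) = 1"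
    and ratio: "\<And>i i'. (\<Sum>j\<in>UNIV. M$i$j) \<le> (1 + t) * (\<Sum>j\<in>UNIV. M$i'$j)"
  shows "(\<Sum>j\<in>UNIV. M$i$j) \<le> 1 + t" "1 \<le> (1 + t) * (\<Sum>j\<in>UNIV. M$i$j)"
proof -
  let ?\<rho> = "\<lambda>i. \<Sum>j\<in>UNIV. M$i$j"
  have total: "(\<Sum>i\<in>UNIV. ?\<rho> i) = real CARD('n)"
    using sum.swap[of "\<lambda>i j. M$i$j" UNIV UNIV] col by simp
  have "(\<Sum>i'\<in>(UNIV::'n set). ?\<rho> i) \<le> (\<Sum>i'\<in>UNIV. (1 + t) * ?\<rho> i')"
    by (intro sum_mono ratio)
  then have "real CARD('n) * ?\<rho> i \<le> real CARD('n) * (1 + t)"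
    by (simp add: sum_distrib_left[symmetric] total mult_ac)
  then show "?\<rho> i \<le> 1 + t" by simp
  have "(\<Sum>i'\<in>(UNIV::'n set). ?\<rho> i') \<le> (\<Sum>i'\<in>(UNIV::'n set). (1 + t) * ?\<rho> i)"
    by (intro sum_mono ratio)
  then have "real CARD('n) * 1 \<le> real CARD('n) * ((1 + t) * ?\<rho> i)"
    by (simp add: total)
  then show "1 \<le> (1 + t) * ?\<rho> i"
    using mult_le_cancel_left_pos[of "real CARD('n)" 1 "(1 + t) * ?\<rho> i"] by simp
qed

text \<open>Sum \<open>bound\<close> over \<open>k\<close> and \<open>l\<close>: on the left column
  \<open>j\<close> contributes 1, on the right the total mass is the dimension.\<close>

lemma entry_lower_bound:
  fixes M :: "real^'n^'n"
  assumes col: "\<And>j. (\<Sum>i\<in>UNIV. M$i$j) = 1"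
    and bound: "\<And>i j k l. \<kappa> * (M$i$l * M$k$j) \<le> M$i$j * M$k$l"
  shows "\<kappa> * (\<Sum>l\<in>UNIV. M$i$l) \<le> real CARD('n) * M$i$j"
proof -
  have total: "(\<Sum>k\<in>UNIV. \<Sum>l\<in>UNIV. M$k$l) = real CARD('n)"
    using sum.swap[of "\<lambda>i j. M$i$j" UNIV UNIV] col by simp
  have "(\<Sum>k\<in>UNIV. \<Sum>l\<in>UNIV. \<kappa> * (M$i$l * M$k$j)) \<le> (\<Sum>k\<in>UNIV. \<Sum>l\<in>UNIV. M$i$j * M$k$l)"
    by (intro sum_mono bound)
  also have "\<dots> = M$i$j * real CARD('n)"
    by (simp add: sum_distrib_left[symmetric] total)
  also have "(\<Sum>k\<in>UNIV. \<Sum>l\<in>UNIV. \<kappa> * (M$i$l * M$k$j))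
      = \<kappa> * ((\<Sum>k\<in>UNIV. M$k$j) * (\<Sum>l\<in>UNIV. M$i$l))"
    by (simp add: sum_product sum_distrib_left mult_ac)
  finally show ?thesis by (simp add: col mult_ac)
qed

text \<open>The new row sums are weighted means of the reciprocals of the old ones, and the least
  reciprocal has weight at least \<open>\<delta>\<close>.\<close>

lemma half_step_contraction:
  fixes M :: "real^'n^'n"
  assumes pos: "\<And>i j. M$i$j > 0"
    and col: "\<And>j. (\<Sum>i\<in>UNIV. M$i$j) = 1"
    and ratio: "\<And>i i'. (\<Sum>j\<in>UNIV. M$i$j) \<le> (1 + t) * (\<Sum>j\<in>UNIV. M$i'$j)"
    and \<delta>: "\<And>i j. \<delta> \<le> M$i$j" and "t \<ge> 0" "\<delta> \<le> 1"
  shows "(\<Sum>j\<in>UNIV. half_step M $ i $ j) \<le> (1 + (1 - \<delta>) * t) * (\<Sum>j\<in>UNIV. half_step M $ i' $ j)"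
proof -
  define u where "u i = 1 / (\<Sum>j\<in>UNIV. M$i$j)" for i
  have u_pos: "u i > 0" for i
    using row_sum_pos[of M i] pos by (simp add: u_def)
  have u_ratio: "u i \<le> (1 + t) * u i'" for i i'
    using row_sum_pos[of M i] row_sum_pos[of M i'] pos ratio[of i' i] by (simp add: u_def field_simps)
  have sums: "(\<Sum>j\<in>UNIV. half_step M $ i $ j) = (\<Sum>j\<in>UNIV. M$j$i * u j)" for i
    by (simp add: half_step_def transpose_nth scale_rows_nth u_def)
  \<comment> \<open>\<open>p\<close> is a row of largest sum, so its reciprocal is the
    least.\<close>
  have "Min (range u) \<in> range u" by (intro Min_in) auto
  then obtain p where "Min (range u) = u p" by blast
  then have p: "u p \<le> u j" for j using Min_le[of "range u" "u j"] by simp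
  have split: "(\<Sum>j\<in>UNIV. f j) = f p + (\<Sum>j\<in>UNIV-{p}. f j)" for f :: "'n \<Rightarrow> real"
    by (simp add: sum.remove[of UNIV p])
  \<comment> \<open>Only the term at \<open>p\<close> is kept exact; every other \<open>u j\<close>
    is replaced by its worst case \<open>(1 + t) * u p\<close>. The weight \<open>M$p$i\<close>, at
    least \<open>\<delta>\<close>, thus escapes the factor \<open>1 + t\<close>, which produces the
    contraction.\<close>
  have "(\<Sum>j\<in>UNIV. M$j$i * u j) \<le> M$p$i * u p + (\<Sum>j\<in>UNIV-{p}. M$j$i * ((1 + t) * u p))"
    unfolding split[of "\<lambda>j. M$j$i * u j"]
    using pos u_ratio by (intro add_mono sum_mono mult_left_mono) (auto intro: less_imp_le)
  also have "\<dots> = M$p$i * u p + (1 - M$p$i) * ((1 + t) * u p)"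
    using split[of "\<lambda>j. M$j$i"] col[of i] by (simp add: sum_distrib_right[symmetric])
  also have "\<dots> = (1 + (1 - M$p$i) * t) * u p" by (simp add: algebra_simps)
  also have "\<dots> \<le> (1 + (1 - \<delta>) * t) * u p"
    using \<delta>[of p i] u_pos[of p] \<open>t \<ge> 0\<close> by (intro mult_right_mono add_left_mono) auto
  also have "u p = (\<Sum>j\<in>UNIV. M$j$i' * u p)"
    using col[of i'] by (simp add: sum_distrib_right[symmetric])
  also have "(1 + (1 - \<delta>) * t) * \<dots> \<le> (1 + (1 - \<delta>) * t) * (\<Sum>j\<in>UNIV. M$j$i' * u j)"
    using p pos \<open>t \<ge> 0\<close> \<open>\<delta> \<le> 1\<close>
    by (intro mult_left_mono sum_mono) (auto intro: less_imp_le)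
  finally show ?thesis by (simp add: sums)
qed

text \<open>Scaling multiplies an entry, itself at most 1, by \<open>1 / \<rho>\<close>, which
  \<open>line_sum_bounds\<close> keeps within \<open>t\<close> of 1. This turns decay of the defect
  into summable increments.\<close>

lemma scale_rows_displacement:
  fixes M :: "real^'n^'n"
  assumes pos: "\<And>i j. M$i$j > 0"
    and col: "\<And>j. (\<Sum>i\<in>UNIV. M$i$j) = 1"
    and ratio: "\<And>i i'. (\<Sum>j\<in>UNIV. M$i$j) \<le> (1 + t) * (\<Sum>j\<in>UNIV. M$i'$j)"
    and "t \<ge> 0"
  shows "\<bar>scale_rows M $ i $ j - M$i$j\<bar> \<le> t"
proof -
  define \<rho> where "\<rho> = (\<Sum>j\<in>UNIV. M$i$j)"
  have "\<rho> > 0" unfolding \<rho>_def by (rule row_sum_pos[OF pos])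
  have b: "\<rho> \<le> 1 + t" "1 \<le> (1 + t) * \<rho>"
    unfolding \<rho>_def by (rule line_sum_bounds[OF pos col ratio])+
  \<comment> \<open>Needed for \<open>1 - t \<le> 1 / \<rho>\<close>. If \<open>\<rho> > 1\<close>,
    then \<open>\<rho> - 1 \<le> t \<le> t * \<rho>\<close>; otherwise the left side is not
    positive.\<close>
  have "\<rho> - 1 \<le> t * \<rho>"
  proof (cases "\<rho> \<le> 1")
    case True
    with \<open>t \<ge> 0\<close> \<open>\<rho> > 0\<close> mult_nonneg_nonneg[of t \<rho>] show ?thesis by linarith
  next
    case False
    with \<open>t \<ge> 0\<close> b(1) mult_left_mono[of 1 \<rho> t] show ?thesis by linarith
  qed
  then have "(1 - t) * \<rho> \<le> 1" by (simp add: algebra_simps)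
  then have "1 - t \<le> 1 / \<rho>"
    using \<open>\<rho> > 0\<close> by (simp only: pos_le_divide_eq)
  moreover have "1 / \<rho> \<le> 1 + t"
    using b(2) \<open>\<rho> > 0\<close> by (simp add: pos_divide_le_eq)
  ultimately have "\<bar>1 / \<rho> - 1\<bar> \<le> t" by linarith
  moreover have "M$i$j \<le> 1"
    using member_le_sum[of i UNIV "\<lambda>i. M$i$j"] pos col[of j] by (auto intro: less_imp_le)
  ultimately have "M$i$j * \<bar>1 / \<rho> - 1\<bar> \<le> 1 * t"
    using pos[of i j] by (intro mult_mono) auto
  moreover have "scale_rows M $ i $ j - M$i$j = M$i$j * (1 / \<rho> - 1)"
    by (simp add: scale_rows_nth \<rho>_def algebra_simps)
  ultimately show ?thesis using pos[of i j] by (simp add: abs_mult)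
qed

section \<open>Uniform constants and geometric decay\<close>

lemma finite_pos_bound_below:
  fixes f :: "'a::finite \<Rightarrow> real"
  assumes "\<And>i. f i > 0"
  obtains m where "m > 0" "\<And>i. m \<le> f i"
proof
  show "Min (range f) > 0" using assms by simp
  show "Min (range f) \<le> f i" for i by simp
qed

text \<open>The lower bound on entries needs control of the row-sum ratios, whose contraction needs
  that lower bound. One \<open>\<delta>\<close> computed from the initial \<open>t\<close> breaks
  the circle: the ratio bound only improves. Indices start at \<open>Suc k\<close> because
  \<open>A\<close> itself need not have unit column sums.\<close>

lemma aligned_seq_geometric:
  fixes A :: "real^'n^'n"
  assumes pos: "\<And>i j. A$i$j > 0"
  obtains \<delta> t where "0 < \<delta>" "\<delta> \<le> 1" "0 \<le> t"
    "\<And>k i j. \<delta> \<le> aligned_seq A (Suc k) $ i $ j"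
    "\<And>k j. (\<Sum>i\<in>UNIV. aligned_seq A (Suc k) $ i $ j) = 1"
    "\<And>k i i'. (\<Sum>j\<in>UNIV. aligned_seq A (Suc k) $ i $ j)
       \<le> (1 + (1 - \<delta>) ^ k * t) * (\<Sum>j\<in>UNIV. aligned_seq A (Suc k) $ i' $ j)"
proof -
  let ?T = "\<lambda>k. aligned_seq A (Suc k)"
  let ?\<rho> = "\<lambda>k i. \<Sum>j\<in>UNIV. ?T k $ i $ j"
  have T_pos: "aligned_seq A k $ i $ j > 0" for k i j
    by (induction k arbitrary: i j) (auto simp: aligned_seq_Suc half_step_pos aligned_seq_def[of A 0] pos)
  have col: "(\<Sum>i\<in>UNIV. ?T k $ i $ j) = 1" for k j
    using half_step_col_sum[OF T_pos] by (simp add: aligned_seq_Suc)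
  let ?c = "\<lambda>(i, j, k, l). A$i$j * A$k$l / (A$i$l * A$k$j)"
  have "?c q > 0" for q using pos by (cases q) simp
  then obtain \<kappa> where "\<kappa> > 0" and \<kappa>: "\<And>q. \<kappa> \<le> ?c q"
    using finite_pos_bound_below[of ?c] by blast
  have bound: "\<kappa> * (aligned_seq A m $ i $ l * aligned_seq A m $ k $ j)
      \<le> aligned_seq A m $ i $ j * aligned_seq A m $ k $ l" for m i j k l
  proof (induction m arbitrary: i j k l)
    case 0
    show ?case using \<kappa>[of "(i, j, k, l)"] pos[of i l] pos[of k j]
      by (simp add: aligned_seq_def pos_le_divide_eq)
  next
    case (Suc m)
    then show ?case unfolding aligned_seq_Suc by (intro half_step_minor_bound T_pos)
  qed
  \<comment> \<open>\<open>1 / m\<close> dominates all ratios of row sums of \<open>?T 0\<close>, so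
    \<open>t = 1 / m\<close> is a generous choice.\<close>
  let ?r = "\<lambda>(i, i'). ?\<rho> 0 i' / ?\<rho> 0 i"
  have "?r p > 0" for p using row_sum_pos[OF T_pos] by (cases p) simp
  then obtain m where "m > 0" and m: "\<And>p. m \<le> ?r p"
    using finite_pos_bound_below[of ?r] by blast
  define t where "t = 1 / m"
  have "t \<ge> 0" using \<open>m > 0\<close> by (simp add: t_def)
  have ratio0: "?\<rho> 0 i \<le> (1 + t) * ?\<rho> 0 i'" for i i'
  proof -
    have "m * ?\<rho> 0 i \<le> ?\<rho> 0 i'"
      using m[of "(i, i')"] row_sum_pos[OF T_pos, of "Suc 0" i] by (simp add: pos_le_divide_eq)
    then have "?\<rho> 0 i \<le> t * ?\<rho> 0 i'"
      using \<open>m > 0\<close> by (simp add: t_def field_simps)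
    then show ?thesis using row_sum_pos[OF T_pos, of "Suc 0" i'] by (simp add: algebra_simps)
  qed
  \<comment> \<open>Row sums are at least \<open>1 / (1 + t)\<close>; inserting this into
    \<open>entry_lower_bound\<close> gives this value.\<close>
  define \<delta> where "\<delta> = \<kappa> / (real CARD('n) * (1 + t))"
  have "\<delta> > 0" using \<open>\<kappa> > 0\<close> \<open>t \<ge> 0\<close> by (simp add: \<delta>_def)
  have lower: "\<delta> \<le> ?T k $ i $ j" if "\<And>i i'. ?\<rho> k i \<le> (1 + t) * ?\<rho> k i'" for k i j
  proof -
    have "\<kappa> * 1 \<le> \<kappa> * ((1 + t) * ?\<rho> k i)"
      using line_sum_bounds(2)[OF T_pos col that] \<open>\<kappa> > 0\<close> by (intro mult_left_mono) auto
    also have "\<dots> \<le> (1 + t) * (real CARD('n) * ?T k $ i $ j)"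
      using mult_left_mono[OF entry_lower_bound[OF col bound, of k i j], of "1 + t"] \<open>t \<ge> 0\<close>
      by (simp add: mult_ac)
    finally have "\<kappa> \<le> ?T k $ i $ j * (real CARD('n) * (1 + t))" by (simp add: mult_ac)
    moreover have "0 < real CARD('n) * (1 + t)" using \<open>t \<ge> 0\<close> by simp
    ultimately show ?thesis unfolding \<delta>_def by (simp only: pos_divide_le_eq)
  qed
  \<comment> \<open>Entries of a positive matrix with unit column sums are at most 1;
    \<open>undefined\<close> is merely some index.\<close>
  have "\<delta> \<le> ?T 0 $ undefined $ undefined" by (rule lower[OF ratio0])
  also have "\<dots> \<le> 1"
    using member_le_sum[of undefined UNIV "\<lambda>i. ?T 0 $ i $ undefined"] T_pos[of "Suc 0"]
      col[of 0 undefined] by (auto intro: less_imp_le)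
  finally have "\<delta> \<le> 1" .
  \<comment> \<open>The decayed ratio bound implies the initial one, so \<open>lower\<close> applies
    inside the induction.\<close>
  have weaken: "?\<rho> k i \<le> (1 + t) * ?\<rho> k i'"
    if "?\<rho> k i \<le> (1 + (1 - \<delta>) ^ k * t) * ?\<rho> k i'" for k i i'
  proof -
    have "(1 - \<delta>) ^ k * t \<le> t"
      using \<open>\<delta> > 0\<close> \<open>\<delta> \<le> 1\<close> \<open>t \<ge> 0\<close> mult_right_mono[OF power_le_one[of "1 - \<delta>" k], of t] by auto
    then show ?thesis
      using that row_sum_pos[OF T_pos, of "Suc k" i']
        mult_right_mono[of "1 + (1 - \<delta>) ^ k * t" "1 + t" "?\<rho> k i'"] by linarith
  qed
  have ratio: "?\<rho> k i \<le> (1 + (1 - \<delta>) ^ k * t) * ?\<rho> k i'" for k i i'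
  proof (induction k arbitrary: i i')
    case 0
    show ?case using ratio0 by simp
  next
    case (Suc k)
    have "0 \<le> (1 - \<delta>) ^ k * t" using \<open>\<delta> \<le> 1\<close> \<open>t \<ge> 0\<close> by simp
    from half_step_contraction[OF T_pos col Suc.IH lower[OF weaken[OF Suc.IH]] this \<open>\<delta> \<le> 1\<close>]
    show ?case unfolding aligned_seq_Suc[of A "Suc k"] by (simp add: mult_ac)
  qed
  show ?thesis
    using that[OF \<open>\<delta> > 0\<close> \<open>\<delta> \<le> 1\<close> \<open>t \<ge> 0\<close>] lower[OF weaken[OF ratio]] col ratio by blast
qed

section \<open>The limit and its properties\<close>

lemma sinkhorn_seq_pos:
  fixes A :: "real^'n^'n"
  assumes "\<And>i j. A$i$j > 0"
  shows "sinkhorn_seq A k $ i $ j > 0"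
proof (induction k arbitrary: i j)
  case (Suc k)
  then have "(\<Sum>l\<in>UNIV. sinkhorn_seq A k $ i $ l) > 0" "(\<Sum>l\<in>UNIV. sinkhorn_seq A k $ l $ j) > 0"
    by (auto intro!: sum_pos)
  with Suc.IH show ?case
    by (simp add: scale_cols_conv_scale_rows scale_rows_nth transpose_nth)
qed (use assms in simp)

text \<open>A step multiplies each entry by a factor of its row and one of its column, so both sides
  acquire the same product. The division-free form passes directly to the limit.\<close>

lemma sinkhorn_seq_cross_ratio:
  fixes A :: "real^'n^'n"
  shows "sinkhorn_seq A m $ i $ j * sinkhorn_seq A m $ k $ l * (A$i$l * A$k$j)
    = sinkhorn_seq A m $ i $ l * sinkhorn_seq A m $ k $ j * (A$i$j * A$k$l)"
proof (induction m)
  case (Suc m)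
  let ?M = "sinkhorn_seq A m"
  define f g where "f i = (if even m then 1 / (\<Sum>j\<in>UNIV. ?M$i$j) else 1)"
    and "g j = (if even m then 1 else 1 / (\<Sum>i\<in>UNIV. ?M$i$j))" for i j
  have scaled: "sinkhorn_seq A (Suc m) $ i $ j = f i * ?M$i$j * g j" for i j
    by (simp add: f_def g_def scale_cols_conv_scale_rows scale_rows_nth transpose_nth)
  have "(f i * a * g j) * (f k * b * g l) * p = (f i * c * g l) * (f k * d * g j) * q"
    if "a * b * p = c * d * q" for a b c d p q
    using that by algebra
  from this[OF Suc.IH] show ?case unfolding scaled .
qed simp

lemma convergent_if_summable_increments:
  fixes f g :: "nat \<Rightarrow> real"
  assumes "summable g" "\<And>n. \<bar>f (Suc n) - f n\<bar> \<le> g n"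
  shows "convergent f"
proof -
  have "summable (\<lambda>n. f (Suc n) - f n)"
    by (rule summable_comparison_test'[OF assms(1), of 0]) (simp add: assms(2))
  then have "convergent (\<lambda>n. f n - f 0)"
    by (simp add: summable_iff_convergent sum_lessThan_telescope)
  then have "convergent (\<lambda>n. (f n - f 0) + f 0)"
    by (intro convergent_add convergent_const)
  then show ?thesis by simp
qed

theorem sinkhorn_limit_properties:
  fixes A :: "real^'n^'n"
  assumes pos: "\<And>i j. A$i$j > 0"
  defines "S \<equiv> sinkhorn_limit A"
  shows "sinkhorn_seq A \<longlonglongrightarrow> S"
    and "S$i$j > 0"
    and "(\<Sum>j\<in>UNIV. S$i$j) = 1"
    and "(\<Sum>i\<in>UNIV. S$i$j) = 1"
    and "S$i$j * S$k$l * (A$i$l * A$k$j) = S$i$l * S$k$j * (A$i$j * A$k$l)"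
proof -
  let ?S = "sinkhorn_seq A" and ?T = "aligned_seq A"
  obtain \<delta> t where \<delta>: "0 < \<delta>" "\<delta> \<le> 1" "0 \<le> t" and lower: "\<And>k i j. \<delta> \<le> ?T (Suc k) $ i $ j"
    and col: "\<And>k j. (\<Sum>i\<in>UNIV. ?T (Suc k) $ i $ j) = 1"
    and ratio: "\<And>k i i'. (\<Sum>j\<in>UNIV. ?T (Suc k) $ i $ j)
       \<le> (1 + (1 - \<delta>) ^ k * t) * (\<Sum>j\<in>UNIV. ?T (Suc k) $ i' $ j)"
    using aligned_seq_geometric[OF pos] by blast
  have T_pos: "?T k $ i $ j > 0" for k i j
    using sinkhorn_seq_pos[OF pos] by (simp add: aligned_seq_def transpose_nth)
  have "\<bar>scale_rows (?T (Suc k)) $ i $ j - ?T (Suc k) $ i $ j\<bar> \<le> (1 - \<delta>) ^ k * t" for k i j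
    using \<delta> by (intro scale_rows_displacement T_pos col ratio) auto
  then have step: "\<bar>?S (Suc (Suc k)) $ i $ j - ?S (Suc k) $ i $ j\<bar> \<le> (1 - \<delta>) ^ k * t" for k i j
    by (simp add: sinkhorn_step_conv_aligned_seq del: sinkhorn_seq.simps)
  have "summable (\<lambda>k. (1 - \<delta>) ^ k * t)"
    using \<delta> by (intro summable_mult2 summable_geometric) auto
  then have "convergent (\<lambda>k. ?S (Suc k) $ i $ j)" for i j
    using step by (intro convergent_if_summable_increments[of "\<lambda>k. (1 - \<delta>) ^ k * t"]) auto
  then have "(\<lambda>k. ?S k $ i $ j) \<longlonglongrightarrow> lim (\<lambda>k. ?S k $ i $ j)" for i j
    unfolding convergent_LIMSEQ_iff[symmetric]
    using convergent_Suc_iff[of "\<lambda>k. ?S k $ i $ j"] by blast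
  then have "?S \<longlonglongrightarrow> (\<chi> i j. lim (\<lambda>k. ?S k $ i $ j))"
    by (intro vec_tendstoI) simp
  then show lim: "?S \<longlonglongrightarrow> S"
    using limI[of ?S] by (simp add: S_def sinkhorn_limit_def)
  have entry: "(\<lambda>k. ?S k $ i $ j) \<longlonglongrightarrow> S$i$j" for i j
    by (intro tendsto_vec_nth lim)
  \<comment> \<open>Positivity alone could be lost in the limit; the uniform bound survives.\<close>
  have "\<delta> \<le> ?S (Suc k) $ i $ j" for k i j
    using lower by (simp add: sinkhorn_seq_conv_aligned_seq transpose_nth del: sinkhorn_seq.simps)
  then have "\<delta> \<le> S$i$j"
    by (intro LIMSEQ_le_const[OF LIMSEQ_Suc[OF entry]]) auto
  with \<delta> show "S$i$j > 0" by simp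
  have "(\<lambda>k. \<Sum>j\<in>UNIV. ?S k $ i $ j) \<longlonglongrightarrow> (\<Sum>j\<in>UNIV. S$i$j)"
    by (intro tendsto_sum entry)
  \<comment> \<open>Terms of odd index come right after a row scaling. Likewise those of positive
    even index, used below, follow a column scaling.\<close>
  then have "(\<lambda>k. \<Sum>j\<in>UNIV. ?S (Suc (2 * k)) $ i $ j) \<longlonglongrightarrow> (\<Sum>j\<in>UNIV. S$i$j)"
    using LIMSEQ_subseq_LIMSEQ[of _ _ "\<lambda>k. Suc (2 * k)"]
    by (auto simp: strict_mono_def o_def simp del: sinkhorn_seq.simps)
  moreover have "(\<Sum>j\<in>UNIV. ?S (Suc (2 * k)) $ i $ j) = 1" for k
    using col[of "2 * k" i] by (simp add: aligned_seq_def transpose_nth del: sinkhorn_seq.simps)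
  ultimately show "(\<Sum>j\<in>UNIV. S$i$j) = 1"
    by (simp add: LIMSEQ_const_iff)
  have "(\<lambda>k. \<Sum>i\<in>UNIV. ?S k $ i $ j) \<longlonglongrightarrow> (\<Sum>i\<in>UNIV. S$i$j)"
    by (intro tendsto_sum entry)
  then have "(\<lambda>k. \<Sum>i\<in>UNIV. ?S (Suc (Suc (2 * k))) $ i $ j) \<longlonglongrightarrow> (\<Sum>i\<in>UNIV. S$i$j)"
    using LIMSEQ_subseq_LIMSEQ[of _ _ "\<lambda>k. Suc (Suc (2 * k))"]
    by (auto simp: strict_mono_def o_def simp del: sinkhorn_seq.simps)
  moreover have "(\<Sum>i\<in>UNIV. ?S (Suc (Suc (2 * k))) $ i $ j) = 1" for k
    using col[of "Suc (2 * k)" j] by (simp add: aligned_seq_def transpose_nth del: sinkhorn_seq.simps)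
  ultimately show "(\<Sum>i\<in>UNIV. S$i$j) = 1"
    by (simp add: LIMSEQ_const_iff)
  have "(\<lambda>m. ?S m $ i $ j * ?S m $ k $ l * (A$i$l * A$k$j))
      \<longlonglongrightarrow> S$i$j * S$k$l * (A$i$l * A$k$j)"
    by (intro tendsto_intros entry)
  moreover have "(\<lambda>m. ?S m $ i $ l * ?S m $ k $ j * (A$i$j * A$k$l))
      \<longlonglongrightarrow> S$i$l * S$k$j * (A$i$j * A$k$l)"
    by (intro tendsto_intros entry)
  ultimately show "S$i$j * S$k$l * (A$i$l * A$k$j) = S$i$l * S$k$j * (A$i$j * A$k$l)"
    unfolding sinkhorn_seq_cross_ratio[of A _ i j k l] using LIMSEQ_unique by blast
qed

section \<open>The sextic relation\<close>

lemma sextic_coeffs_scale: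
  fixes A S :: "real^3^3" and r c :: "3 \<Rightarrow> real"
  assumes "\<And>i j. A$i$j = r i * S$i$j * c j"
  defines "\<mu> \<equiv> r 1 ^ 5 * (r 2 * r 3) ^ 3 * (c 1 ^ 5 * (c 2 * c 3) ^ 3)"
  shows "sinkhorn_b6 A = \<mu> * sinkhorn_b6 S" "sinkhorn_b5 A = \<mu> * sinkhorn_b5 S"
    "sinkhorn_b4 A = \<mu> * sinkhorn_b4 S" "sinkhorn_b3 A = \<mu> * sinkhorn_b3 S"
    "sinkhorn_b2 A = \<mu> * sinkhorn_b2 S" "sinkhorn_b1 A = \<mu> * sinkhorn_b1 S"
    "sinkhorn_b0 A = \<mu> * sinkhorn_b0 S"
  unfolding sinkhorn_b6_def sinkhorn_b5_def sinkhorn_b4_def sinkhorn_b3_def sinkhorn_b2_def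
    sinkhorn_b1_def sinkhorn_b0_def assms
  by (simp_all add: algebra_simps power2_eq_square power3_eq_cube eval_nat_numeral)

lemma sextic_doubly_stochastic:
  fixes S :: "real^3^3"
  assumes row: "\<And>i. (\<Sum>j\<in>UNIV. S$i$j) = 1" and col: "\<And>j. (\<Sum>i\<in>UNIV. S$i$j) = 1"
  defines "x \<equiv> S$1$1"
  shows "sinkhorn_b6 S * x^6 + sinkhorn_b5 S * x^5 + sinkhorn_b4 S * x^4 + sinkhorn_b3 S * x^3
    + sinkhorn_b2 S * x^2 + sinkhorn_b1 S * x + sinkhorn_b0 S = 0"
proof -
  define a b c d where "a = S$1$1" "b = S$1$2" "c = S$2$1" "d = S$2$2"
  note abcd = this[symmetric]
  \<comment> \<open>Five line-sum equations determine the five entries outside the upper left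
    block.\<close>
  have S: "S$1$3 = 1 - a - b" "S$2$3 = 1 - c - d" "S$3$1 = 1 - a - c" "S$3$2 = 1 - b - d"
    "S$3$3 = a + b + c + d - 1"
    using row[of 1] row[of 2] row[of 3] col[of 1] col[of 2] abcd unfolding sum_3 by linarith+
  show ?thesis
    unfolding x_def sinkhorn_b6_def sinkhorn_b5_def sinkhorn_b4_def sinkhorn_b3_def sinkhorn_b2_def
      sinkhorn_b1_def sinkhorn_b0_def S abcd
    by algebra
qed

theorem theorem2p1:
  fixes A :: "real^3^3" and x :: real
  assumes "\<And>i j. A$i$j > 0"
    and "x = sinkhorn_limit A $ 1 $ 1"
  shows "sinkhorn_b6 A * x^6 + sinkhorn_b5 A * x^5 + sinkhorn_b4 A * x^4 + sinkhorn_b3 A * x^3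
    + sinkhorn_b2 A * x^2 + sinkhorn_b1 A * x + sinkhorn_b0 A = 0"
proof -
  define S where "S = sinkhorn_limit A"
  note lim = sinkhorn_limit_properties[of A, folded S_def, OF assms(1)]
  \<comment> \<open>Solving the cross-ratio identity with \<open>k = l = 1\<close> for
    \<open>A$i$j\<close> gives these factors, normalised so that \<open>c 1 = 1\<close>.\<close>
  define r where "r i = A$i$1 / S$i$1" for i
  define c where "c j = A$1$j * S$1$1 / (S$1$j * A$1$1)" for j
  define \<mu> where "\<mu> = r 1 ^ 5 * (r 2 * r 3) ^ 3 * (c 1 ^ 5 * (c 2 * c 3) ^ 3)"
  have "A$i$j = r i * S$i$j * c j" for i j
    using lim(5)[of i j 1 1] lim(2)[of i 1] lim(2)[of 1 j] assms(1)[of 1 1]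
    by (simp add: r_def c_def field_simps)
  note scale = sextic_coeffs_scale[OF this, folded \<mu>_def]
  have x: "x = S$1$1" by (simp add: S_def assms(2))
  have "sinkhorn_b6 A * x^6 + sinkhorn_b5 A * x^5 + sinkhorn_b4 A * x^4 + sinkhorn_b3 A * x^3
      + sinkhorn_b2 A * x^2 + sinkhorn_b1 A * x + sinkhorn_b0 A
    = \<mu> * (sinkhorn_b6 S * x^6 + sinkhorn_b5 S * x^5 + sinkhorn_b4 S * x^4 + sinkhorn_b3 S * x^3
      + sinkhorn_b2 S * x^2 + sinkhorn_b1 S * x + sinkhorn_b0 S)"
    unfolding scale by (simp only: distrib_left mult.assoc)
  also have "\<dots> = 0"
    unfolding x using sextic_doubly_stochastic[OF lim(3,4)] by simp
  finally show ?thesis .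
qed

end
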